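(* Let $p,d\geq1$. Among all pairs $(A,B)$ of $p\times d$ matrices with entries in $\mathbb{R}\cup\{-\infty\}$, the maximal number of extreme rays of the tropical cone $\{x\in(\mathbb{R}\cup\{-\infty\})^d: \max_j(A_{ij}+x_j)\leq\max_j(B_{ij}+x_j),\ 1\leq i\leq p\}$ is attained by a pair $(A,B)$ whose inequalities are in general position.
   Context: Tropical conventions: $\mathbb{R}_{\max}=\mathbb{R}\cup\{-\infty\}$ with $\oplus=\max$, $\otimes=+$; a tropical cone is closed under $(u,v)\mapsto\lambda u\oplus\mu v$ where $\lambda u=(\lambda+u_j)_j$ and $\oplus$ is entrywise max; an extreme generator is a vector $u\neq(-\infty,\dots,-\infty)$ of the cone such that $u=v\oplus w$ with $v,w$ in the cone implies $u=v$ or $u=w$; an extreme ray is the set of tropical scalar multiples of an extreme generator. A $k\times k$ matrix $M$ over $\mathbb{R}_{\max}$ is tropically non-singular if its tropical permanent $\max_{\sigma\in S_k}\sum_{i=1}^k M_{i\sigma(i)}$ is finite and attained by exactly one permutation $\sigma$. A system of inequalities $\max_j(A_{ij}+x_j)\leq\max_j(B_{ij}+x_j)$, $1\leq i\leq p$, with $A_{ij}+B_{ij}=-\infty$ for all $i,j$ (i.e. at least one of $A_{ij},B_{ij}$ is $-\infty$), is in general position if every square submatrix of $C=A\oplus B$ (entrywise max) is tropically non-singular. *)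

theory Defs
  imports
    "HOL-Library.Extended_Real"
    "HOL-Combinatorics.Permutations"
    "Jordan_Normal_Form.DL_Submatrix"
begin

text \<open>
  The tropical semiring is the part of the extended reals below \<open>\<infinity>\<close>, with \<open>max\<close> as addition and
  \<open>+\<close> as multiplication. There \<open>-\<infinity>\<close> is absorbing for \<open>+\<close>; since \<open>-\<infinity> + \<infinity> = \<infinity>\<close> in type \<open>ereal\<close>,
  all scalars, vectors and matrices have to be kept away from \<open>\<infinity>\<close>. Indices start at \<open>0\<close>.
\<close>

definition rmax :: "ereal set" where
  "rmax = {x. x \<noteq> \<infinity>}"

definition rmax_vec :: "nat \<Rightarrow> ereal vec set" where
  "rmax_vec d = {x \<in> carrier_vec d. \<forall>j<d. x $ j \<in> rmax}"

definition rmax_mat :: "nat \<Rightarrow> nat \<Rightarrow> ereal mat set" where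
  "rmax_mat p d = {A \<in> carrier_mat p d. \<forall>i<p. \<forall>j<d. A $$ (i, j) \<in> rmax}"

definition trop_add_vec :: "ereal vec \<Rightarrow> ereal vec \<Rightarrow> ereal vec" where
  "trop_add_vec u v = vec (dim_vec u) (\<lambda>j. max (u $ j) (v $ j))"

definition trop_smult_vec :: "ereal \<Rightarrow> ereal vec \<Rightarrow> ereal vec" where
  "trop_smult_vec c u = vec (dim_vec u) (\<lambda>j. c + u $ j)"

definition trop_zero_vec :: "nat \<Rightarrow> ereal vec" where
  "trop_zero_vec d = vec d (\<lambda>_. -\<infinity>)"

definition trop_add_mat :: "ereal mat \<Rightarrow> ereal mat \<Rightarrow> ereal mat" where
  "trop_add_mat A B = mat (dim_row A) (dim_col A) (\<lambda>(i, j). max (A $$ (i, j)) (B $$ (i, j)))"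

definition ineq_cone :: "ereal mat \<Rightarrow> ereal mat \<Rightarrow> ereal vec set" where
  "ineq_cone A B = {x \<in> rmax_vec (dim_col A). \<forall>i<dim_row A.
     (MAX j\<in>{..<dim_col A}. A $$ (i, j) + x $ j) \<le> (MAX j\<in>{..<dim_col A}. B $$ (i, j) + x $ j)}"

definition extreme_generator :: "ereal vec set \<Rightarrow> ereal vec \<Rightarrow> bool" where
  "extreme_generator V u \<longleftrightarrow> u \<in> V \<and> u \<noteq> trop_zero_vec (dim_vec u) \<and>
     (\<forall>v\<in>V. \<forall>w\<in>V. u = trop_add_vec v w \<longrightarrow> u = v \<or> u = w)"

definition trop_ray :: "ereal vec \<Rightarrow> ereal vec set" where
  "trop_ray u = {trop_smult_vec c u | c. c \<in> rmax}"

definition extreme_rays :: "ereal vec set \<Rightarrow> ereal vec set set" where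
  "extreme_rays V = {trop_ray u | u. extreme_generator V u}"

definition trop_weight :: "ereal mat \<Rightarrow> (nat \<Rightarrow> nat) \<Rightarrow> ereal" where
  "trop_weight M \<sigma> = (\<Sum>i<dim_row M. M $$ (i, \<sigma> i))"

definition trop_permanent :: "ereal mat \<Rightarrow> ereal" where
  "trop_permanent M = (MAX \<sigma>\<in>{\<sigma>. \<sigma> permutes {..<dim_row M}}. trop_weight M \<sigma>)"

definition trop_nonsingular :: "ereal mat \<Rightarrow> bool" where
  "trop_nonsingular M \<longleftrightarrow> dim_row M = dim_col M \<and> \<bar>trop_permanent M\<bar> \<noteq> \<infinity> \<and>
     (\<exists>!\<sigma>. \<sigma> permutes {..<dim_row M} \<and> trop_weight M \<sigma> = trop_permanent M)"

definition general_position :: "ereal mat \<Rightarrow> ereal mat \<Rightarrow> bool" where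
  "general_position A B \<longleftrightarrow>
     (\<forall>i<dim_row A. \<forall>j<dim_col A. A $$ (i, j) + B $$ (i, j) = -\<infinity>) \<and>
     (\<forall>I J. I \<subseteq> {..<dim_row A} \<and> J \<subseteq> {..<dim_col A} \<and> card I = card J \<longrightarrow>
        trop_nonsingular (submatrix (trop_add_mat A B) I J))"

end

theory Submission
  imports Defs "HOL-Library.FuncSet" "HOL-Library.Nat_Bijection"
    "HOL-Computational_Algebra.Polynomial"
begin

text \<open>
  Choosing, for each row \<open>i\<close>, an index \<open>f i\<close> that attains the maximum on the right-hand side
  decomposes the cone into finitely many cells. Cells are closed under entrywise infima, and extreme
  rays correspond to vectors that are minimal in the cone among those with \<open>j\<close>-th entry \<open>0\<close>.
  Such a vector is the least point with \<open>j\<close>-th entry \<open>0\<close> of a cell, so there are at most \<open>d * d ^ p\<close>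
  extreme rays.

  Now discard from each pair \<open>A $$ e\<close>, \<open>B $$ e\<close> the smaller entry, and relax the inequalities: lower
  finite entries on the left, raise entries on the right, with distinct powers of \<open>1 / (k + 1)\<close>,
  replacing \<open>-\<infinity>\<close> by about \<open>-(k + 1)\<close> where both are \<open>-\<infinity>\<close>. For large \<open>k\<close> two distinct sets of entries
  have distinct sums, so the relaxed pair is in general position. The relaxed cones contain the
  original cone, and the least points of their cells increase with \<open>k\<close>, with limits in the original
  cone if bounded by one of its elements. Hence each extreme ray is a limit of extreme rays of the
  relaxed cones, and for large \<open>k\<close> these are at least as many.
\<close>

section \<open>Cells and minimal generators\<close>

definition trop_cell :: "ereal mat \<Rightarrow> ereal mat \<Rightarrow> (nat \<Rightarrow> nat) \<Rightarrow> ereal vec set" where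
  "trop_cell A B f = {x \<in> rmax_vec (dim_col A). \<forall>i<dim_row A. \<forall>l<dim_col A.
     A $$ (i, l) + x $ l \<le> B $$ (i, f i) + x $ f i}"

text \<open>If the cell does not meet \<open>x $ j = 0\<close>, all entries of this vector are \<open>\<infinity>\<close>.\<close>

definition cell_min :: "ereal mat \<Rightarrow> ereal mat \<Rightarrow> (nat \<Rightarrow> nat) \<Rightarrow> nat \<Rightarrow> ereal vec" where
  "cell_min A B f j = vec (dim_col A) (\<lambda>l. INF x\<in>{x \<in> trop_cell A B f. x $ j = 0}. x $ l)"

text \<open>Normalising the \<open>j\<close>-th entry to \<open>0\<close> picks one representative
  of a ray. Extremality will amount to being minimal, up to scaling, for some
  \<open>j\<close>.\<close>

definition minimal_generator :: "ereal vec set \<Rightarrow> nat \<Rightarrow> ereal vec \<Rightarrow> bool" where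
  "minimal_generator V j u \<longleftrightarrow> u \<in> V \<and> u $ j = 0 \<and> (\<forall>v\<in>V. v \<le> u \<and> v $ j = 0 \<longrightarrow> v = u)"

abbreviation choices :: "nat \<Rightarrow> nat \<Rightarrow> (nat \<Rightarrow> nat) set" where
  "choices p d \<equiv> {..<p} \<rightarrow>\<^sub>E {..<d}"

section \<open>Entries, dimensions and membership in the cone\<close>

lemma rmax_vec_less_top: "x \<in> rmax_vec d \<Longrightarrow> j < d \<Longrightarrow> x $ j \<noteq> \<infinity>"
  by (auto simp: rmax_vec_def rmax_def)

lemma rmax_vec_dim: "x \<in> rmax_vec d \<Longrightarrow> dim_vec x = d"
  by (auto simp: rmax_vec_def)

lemma rmax_vecI: "dim_vec x = d \<Longrightarrow> (\<And>j. j < d \<Longrightarrow> x $ j \<noteq> \<infinity>) \<Longrightarrow> x \<in> rmax_vec d"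
  unfolding rmax_vec_def rmax_def carrier_vec_def by blast

lemma rmax_mat_dim: "A \<in> rmax_mat p d \<Longrightarrow> dim_row A = p" "A \<in> rmax_mat p d \<Longrightarrow> dim_col A = d"
  by (auto simp: rmax_mat_def)

lemma rmax_mat_less_top: "A \<in> rmax_mat p d \<Longrightarrow> i < p \<Longrightarrow> j < d \<Longrightarrow> A $$ (i, j) \<noteq> \<infinity>"
  by (auto simp: rmax_mat_def rmax_def)

lemma less_eq_vec_dimD: "x \<le> y \<Longrightarrow> dim_vec x = dim_vec y"
  by (simp add: less_eq_vec_def)

lemma less_eq_vec_indexD: "x \<le> y \<Longrightarrow> l < dim_vec y \<Longrightarrow> x $ l \<le> y $ l"
  by (simp add: less_eq_vec_def)

lemma rmax_vec_le:
  assumes "x \<le> y" "y \<in> rmax_vec d" shows "x \<in> rmax_vec d"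
proof (rule rmax_vecI)
  show "dim_vec x = d" using assms less_eq_vec_dimD rmax_vec_dim by metis
  fix j assume "j < d"
  then have "x $ j \<le> y $ j" "y $ j \<noteq> \<infinity>"
    using assms less_eq_vec_indexD rmax_vec_less_top rmax_vec_dim by metis+
  then show "x $ j \<noteq> \<infinity>" by auto
qed

text \<open>As \<open>d \<ge> 1\<close>, both maxima run over nonempty finite sets and the
  right-hand one is attained at some \<open>b\<close>. Trading \<open>Max\<close> for this witness
  leads to the cells.\<close>

lemma mem_ineq_cone_iff:
  assumes "A \<in> rmax_mat p d" "d \<ge> 1"
  shows "x \<in> ineq_cone A B \<longleftrightarrow> x \<in> rmax_vec d \<and>
    (\<forall>i<p. \<exists>b<d. \<forall>l<d. A $$ (i, l) + x $ l \<le> B $$ (i, b) + x $ b)"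
proof -
  have ne: "{..<d} \<noteq> {}" using assms(2) by (simp add: lessThan_empty_iff)
  have "(MAX j\<in>{..<d}. A $$ (i, j) + x $ j) \<le> (MAX j\<in>{..<d}. B $$ (i, j) + x $ j) \<longleftrightarrow>
      (\<exists>b<d. \<forall>l<d. A $$ (i, l) + x $ l \<le> B $$ (i, b) + x $ b)" (is "?L \<longleftrightarrow> ?R") for i
  proof -
    have "?L \<longleftrightarrow> (\<exists>b<d. (MAX j\<in>{..<d}. A $$ (i, j) + x $ j) \<le> B $$ (i, b) + x $ b)"
      using ne by (subst Max_ge_iff) auto
    also have "\<dots> \<longleftrightarrow> ?R"
      using ne by (subst Max_le_iff) auto
    finally show ?thesis .
  qed
  then show ?thesis
    unfolding ineq_cone_def using rmax_mat_dim[OF assms(1)] by simp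
qed

lemma ineq_cone_rmax: "A \<in> rmax_mat p d \<Longrightarrow> x \<in> ineq_cone A B \<Longrightarrow> x \<in> rmax_vec d"
  by (auto simp: ineq_cone_def rmax_mat_dim)

lemma trop_cell_rmax: "A \<in> rmax_mat p d \<Longrightarrow> x \<in> trop_cell A B f \<Longrightarrow> x \<in> rmax_vec d"
  by (auto simp: trop_cell_def rmax_mat_dim)

lemma ineq_cone_eq_Union_cells:
  assumes "A \<in> rmax_mat p d" "d \<ge> 1"
  shows "ineq_cone A B = (\<Union>f\<in>choices p d. trop_cell A B f)"
proof (intro equalityI subsetI)
  fix x assume x: "x \<in> ineq_cone A B"
  then obtain f where f: "\<And>i. i < p \<Longrightarrow> f i < d \<and> (\<forall>l<d. A $$ (i, l) + x $ l \<le> B $$ (i, f i) + x $ f i)"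
    using mem_ineq_cone_iff[OF assms] by metis
  \<comment> \<open>Restricting makes \<open>f\<close> extensional, so only finitely many choice
    functions occur.\<close>
  then have "restrict f {..<p} \<in> choices p d" "x \<in> trop_cell A B (restrict f {..<p})"
    using x by (auto simp: trop_cell_def rmax_mat_dim[OF assms(1)] mem_ineq_cone_iff[OF assms])
  then show "x \<in> (\<Union>f\<in>choices p d. trop_cell A B f)" by blast
next
  fix x assume "x \<in> (\<Union>f\<in>choices p d. trop_cell A B f)"
  then show "x \<in> ineq_cone A B"
    unfolding mem_ineq_cone_iff[OF assms]
    by (fastforce simp: trop_cell_def rmax_mat_dim[OF assms(1)] PiE_iff)
qed

section \<open>Least points of cells\<close>

lemma cell_min_le:
  assumes "A \<in> rmax_mat p d" "x \<in> trop_cell A B f" "x $ j = 0"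
  shows "cell_min A B f j \<le> x"
proof -
  have "(INF y\<in>{y \<in> trop_cell A B f. y $ j = 0}. y $ l) \<le> x $ l" for l
    using assms(2,3) by (intro INF_lower) simp
  then show ?thesis
    using rmax_mat_dim[OF assms(1)] rmax_vec_dim[OF trop_cell_rmax[OF assms(1,2)]]
    by (simp add: less_eq_vec_def cell_min_def)
qed

text \<open>The inequalities of a cell are difference constraints between two coordinates, hence are
  inherited by entrywise infima.\<close>

lemma cell_min_mem:
  assumes A: "A \<in> rmax_mat p d" and B: "B \<in> rmax_mat p d" and f: "f \<in> choices p d" and j: "j < d"
    and rmax: "cell_min A B f j \<in> rmax_vec d"
  shows "cell_min A B f j \<in> trop_cell A B f" "cell_min A B f j $ j = 0"
proof -
  define S where "S = {x \<in> trop_cell A B f. x $ j = 0}"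
  have m: "cell_min A B f j $ l = (INF x\<in>S. x $ l)" if "l < d" for l
    using that by (simp add: cell_min_def S_def rmax_mat_dim[OF A])
  \<comment> \<open>An empty \<open>S\<close> would give the infimum \<open>\<infinity>\<close> in
    entry \<open>j\<close>, which \<open>rmax_vec d\<close> excludes.\<close>
  have "S \<noteq> {}"
    using rmax_vec_less_top[OF rmax j] m[OF j] by (auto simp: top_ereal_def)
  then show "cell_min A B f j $ j = 0"
    using m[OF j] by (auto simp: S_def)
  have "A $$ (i, l) + cell_min A B f j $ l \<le> B $$ (i, f i) + cell_min A B f j $ f i"
    if i: "i < p" and l: "l < d" for i l
  proof -
    have fi: "f i < d" using f i by auto
    have *: "A $$ (i, l) + cell_min A B f j $ l \<le> B $$ (i, f i) + x $ f i" if "x \<in> S" for x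
    proof -
      have "A $$ (i, l) + cell_min A B f j $ l \<le> A $$ (i, l) + x $ l"
        using that l by (auto simp: m intro!: add_left_mono INF_lower)
      also have "\<dots> \<le> B $$ (i, f i) + x $ f i"
        using that i l by (simp add: S_def trop_cell_def rmax_mat_dim[OF A])
      finally show ?thesis .
    qed
    show ?thesis
    \<comment> \<open>A finite right entry can be moved to the left, giving a lower bound for
      \<open>x $ f i\<close> uniform in \<open>x \<in> S\<close>, hence for the infimum. If that
      entry is \<open>-\<infinity>\<close>, one element of \<open>S\<close> already forces the
      left-hand side to be \<open>-\<infinity>\<close>.\<close>
    proof (cases "B $$ (i, f i)")
      case (real r)
      have "A $$ (i, l) + cell_min A B f j $ l - B $$ (i, f i) \<le> cell_min A B f j $ f i"
        unfolding m[OF fi] using * real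
        by (intro INF_greatest) (auto simp: m ereal_minus_le_iff add.commute)
      then show ?thesis using real by (simp add: ereal_minus_le_iff add.commute)
    next
      case PInf
      then show ?thesis using rmax_mat_less_top[OF B i fi] by simp
    next
      case MInf
      obtain x where x: "x \<in> S" using \<open>S \<noteq> {}\<close> by blast
      have "x $ f i \<noteq> \<infinity>"
        using x rmax_vec_less_top[OF trop_cell_rmax[OF A] fi] by (auto simp: S_def)
      then have "B $$ (i, f i) + x $ f i = -\<infinity>" using MInf by (cases "x $ f i") auto
      then have "A $$ (i, l) + cell_min A B f j $ l \<le> -\<infinity>" using *[OF x] by (simp only:)
      then show ?thesis by (rule order_trans) simp
    qed
  qed
  then show "cell_min A B f j \<in> trop_cell A B f"
    using rmax by (simp add: trop_cell_def rmax_mat_dim[OF A])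
qed

text \<open>Each cone element with \<open>j\<close>-th entry \<open>0\<close> lies above the least
  point of some cell, and there are finitely many cells. So a minimal one among the least points
  below \<open>x\<close> is minimal in the whole cone.\<close>

lemma minimal_generator_below:
  assumes A: "A \<in> rmax_mat p d" and B: "B \<in> rmax_mat p d" and j: "j < d"
    and x: "x \<in> ineq_cone A B" "x $ j = 0"
  obtains f where "f \<in> choices p d" "minimal_generator (ineq_cone A B) j (cell_min A B f j)"
    "cell_min A B f j \<le> x"
proof -
  have d: "d \<ge> 1" using j by simp
  note U = ineq_cone_eq_Union_cells[OF A d, of B]
  have below: "\<exists>f\<in>choices p d. cell_min A B f j \<le> y" if y: "y \<in> ineq_cone A B" "y $ j = 0" for y
  proof -
    obtain f where "f \<in> choices p d" "y \<in> trop_cell A B f" using y(1) unfolding U by auto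
    then show ?thesis using cell_min_le[OF A _ y(2)] by (intro bexI)
  qed
  define M where "M = {m \<in> (\<lambda>f. cell_min A B f j) ` choices p d. m \<le> x}"
  have "finite (choices p d)" by (simp add: finite_PiE)
  then have "finite M" by (simp add: M_def)
  moreover have "M \<noteq> {}"
  proof -
    obtain f where "f \<in> choices p d" "cell_min A B f j \<le> x" using below[OF x] by (elim bexE)
    then have "cell_min A B f j \<in> M" by (simp add: M_def)
    then show ?thesis by auto
  qed
  ultimately obtain m where m: "m \<in> M" and min: "\<And>m'. m' \<in> M \<Longrightarrow> m' \<le> m \<Longrightarrow> m = m'"
    using finite_has_minimal[of M] by blast
  obtain f where f: "f \<in> choices p d" "m = cell_min A B f j" "m \<le> x"
    using m by (auto simp: M_def)
  have "m \<in> rmax_vec d" by (rule rmax_vec_le[OF f(3) ineq_cone_rmax[OF A x(1)]])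
  then have m_mem: "m \<in> ineq_cone A B" "m $ j = 0"
    using cell_min_mem[OF A B f(1) j] f by (auto simp: U)
  have "v = m" if v: "v \<in> ineq_cone A B" "v \<le> m" "v $ j = 0" for v
  proof -
    obtain g where g: "g \<in> choices p d" "cell_min A B g j \<le> v" using below[OF v(1,3)] by (elim bexE)
    then have "cell_min A B g j \<in> M" using v(2) f(3) by (auto simp: M_def)
    then have "m = cell_min A B g j" using min g(2) v(2) by force
    then show ?thesis using g(2) v(2) by simp
  qed
  then have "minimal_generator (ineq_cone A B) j m"
    using m_mem by (auto simp: minimal_generator_def)
  then show thesis using that f by blast
qed

lemma minimal_generator_eq_cell_min:
  assumes "A \<in> rmax_mat p d" "B \<in> rmax_mat p d" "j < d" "minimal_generator (ineq_cone A B) j u"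
  obtains f where "f \<in> choices p d" "u = cell_min A B f j"
proof -
  have u: "u \<in> ineq_cone A B" "u $ j = 0" using assms(4) by (auto simp: minimal_generator_def)
  obtain f where f: "f \<in> choices p d" "minimal_generator (ineq_cone A B) j (cell_min A B f j)"
    "cell_min A B f j \<le> u"
    by (rule minimal_generator_below[OF assms(1-3) u])
  then have "cell_min A B f j = u" using assms(4) by (simp add: minimal_generator_def)
  then show thesis using that[OF f(1)] by simp
qed

section \<open>Tropical operations on the cone; extreme versus minimal generators\<close>

lemma trop_add_vec_in_cone:
  assumes A: "A \<in> rmax_mat p d" and d: "d \<ge> 1"
    and v: "v \<in> ineq_cone A B" and w: "w \<in> ineq_cone A B"
  shows "trop_add_vec v w \<in> ineq_cone A B"
proof -
  have vw: "v \<in> rmax_vec d" "w \<in> rmax_vec d" using ineq_cone_rmax[OF A] v w by auto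
  have idx: "trop_add_vec v w $ l = max (v $ l) (w $ l)" if "l < d" for l
    using that vw by (simp add: trop_add_vec_def rmax_vec_dim)
  have "\<exists>b<d. \<forall>l<d. A $$ (i, l) + trop_add_vec v w $ l \<le> B $$ (i, b) + trop_add_vec v w $ b"
    if i: "i < p" for i
  proof -
    obtain b c where b: "b < d" "\<And>l. l < d \<Longrightarrow> A $$ (i, l) + v $ l \<le> B $$ (i, b) + v $ b"
      and c: "c < d" "\<And>l. l < d \<Longrightarrow> A $$ (i, l) + w $ l \<le> B $$ (i, c) + w $ c"
      using v w i unfolding mem_ineq_cone_iff[OF A d] by metis
    \<comment> \<open>Of the two witnesses, \<open>e\<close> is the one with the larger right-hand
      term; that term in the sum bounds both left-hand sides.\<close>
    define e where "e = (if B $$ (i, b) + v $ b \<le> B $$ (i, c) + w $ c then c else b)"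
    have e: "e < d" "B $$ (i, b) + v $ b \<le> B $$ (i, e) + trop_add_vec v w $ e"
      "B $$ (i, c) + w $ c \<le> B $$ (i, e) + trop_add_vec v w $ e"
    proof -
      have "B $$ (i, c) + w $ c \<le> B $$ (i, c) + trop_add_vec v w $ c"
        "B $$ (i, b) + v $ b \<le> B $$ (i, b) + trop_add_vec v w $ b"
        using b(1) c(1) by (auto simp: idx intro!: add_left_mono)
      then show "e < d" "B $$ (i, b) + v $ b \<le> B $$ (i, e) + trop_add_vec v w $ e"
        "B $$ (i, c) + w $ c \<le> B $$ (i, e) + trop_add_vec v w $ e"
        using b(1) c(1) by (auto simp: e_def)
    qed
    have "A $$ (i, l) + trop_add_vec v w $ l \<le> B $$ (i, e) + trop_add_vec v w $ e" if "l < d" for l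
      using b(2)[OF that] c(2)[OF that] e(2,3) by (auto simp: idx[OF that] max_def)
    then show ?thesis using e(1) by blast
  qed
  moreover have "trop_add_vec v w \<in> rmax_vec d"
    using vw rmax_vec_less_top by (intro rmax_vecI) (auto simp: trop_add_vec_def rmax_vec_dim max_def)
  ultimately show ?thesis unfolding mem_ineq_cone_iff[OF A d] by blast
qed

lemma trop_smult_vec_in_cone:
  assumes A: "A \<in> rmax_mat p d" and d: "d \<ge> 1" and v: "v \<in> ineq_cone A B" and c: "c \<in> rmax"
  shows "trop_smult_vec c v \<in> ineq_cone A B"
proof -
  have vr: "v \<in> rmax_vec d" using ineq_cone_rmax[OF A] v by auto
  have idx: "trop_smult_vec c v $ l = c + v $ l" if "l < d" for l
    using that vr by (simp add: trop_smult_vec_def rmax_vec_dim)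
  have "\<exists>b<d. \<forall>l<d. A $$ (i, l) + trop_smult_vec c v $ l \<le> B $$ (i, b) + trop_smult_vec c v $ b"
    if i: "i < p" for i
  proof -
    obtain b where b: "b < d" "\<And>l. l < d \<Longrightarrow> A $$ (i, l) + v $ l \<le> B $$ (i, b) + v $ b"
      using v i unfolding mem_ineq_cone_iff[OF A d] by metis
    have "A $$ (i, l) + (c + v $ l) \<le> B $$ (i, b) + (c + v $ b)" if "l < d" for l
      using add_left_mono[OF b(2)[OF that], of c] by (simp add: add.left_commute)
    then show ?thesis using b(1) idx by auto
  qed
  moreover have "trop_smult_vec c v \<in> rmax_vec d"
    using vr c rmax_vec_less_top
    by (intro rmax_vecI) (auto simp: trop_smult_vec_def rmax_vec_dim rmax_def)
  ultimately show ?thesis unfolding mem_ineq_cone_iff[OF A d] by blast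
qed

lemma trop_zero_vec_in_cone:
  assumes A: "A \<in> rmax_mat p d" and B: "B \<in> rmax_mat p d" and d: "d \<ge> 1"
  shows "trop_zero_vec d \<in> ineq_cone A B"
proof -
  \<comment> \<open>In \<open>ereal\<close> the sum \<open>\<infinity> + -\<infinity>\<close> is
    \<open>\<infinity>\<close>, so the bound on the entries of \<open>A\<close> matters
    here.\<close>
  have "A $$ (i, l) + -\<infinity> \<le> B $$ (i, 0) + -\<infinity>" if "i < p" "l < d" for i l
    using rmax_mat_less_top[OF A that] by (cases "A $$ (i, l)") auto
  then show ?thesis
    using d unfolding mem_ineq_cone_iff[OF A d]
    by (auto intro!: rmax_vecI exI[of _ 0] simp: trop_zero_vec_def)
qed

text \<open>If \<open>u\<close> is a tropical sum, both summands lie below \<open>u\<close> and one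
  of them has the same \<open>j\<close>-th entry \<open>0\<close>; minimality makes that one equal
  to \<open>u\<close>.\<close>

lemma minimal_generator_extreme:
  assumes A: "A \<in> rmax_mat p d" and j: "j < d" and u: "minimal_generator (ineq_cone A B) j u"
  shows "extreme_generator (ineq_cone A B) u"
proof -
  have ur: "u \<in> rmax_vec d" using u ineq_cone_rmax[OF A] by (auto simp: minimal_generator_def)
  have "u \<noteq> trop_zero_vec (dim_vec u)"
    using u j ur by (auto simp: minimal_generator_def trop_zero_vec_def rmax_vec_dim)
  moreover have "u = v \<or> u = w" if v: "v \<in> ineq_cone A B" and w: "w \<in> ineq_cone A B"
    and eq: "u = trop_add_vec v w" for v w
  proof -
    have vw: "v \<in> rmax_vec d" "w \<in> rmax_vec d" using ineq_cone_rmax[OF A] v w by auto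
    have idx: "u $ l = max (v $ l) (w $ l)" if "l < d" for l
      using that vw by (simp add: eq trop_add_vec_def rmax_vec_dim)
    have "v \<le> u" "w \<le> u" using vw ur idx by (auto simp: less_eq_vec_def rmax_vec_dim)
    moreover have "v $ j = 0 \<or> w $ j = 0"
      using idx[OF j] u by (auto simp: minimal_generator_def max_def split: if_splits)
    ultimately show ?thesis using u v w by (auto simp: minimal_generator_def)
  qed
  ultimately show ?thesis
    using u by (auto simp: extreme_generator_def minimal_generator_def)
qed

text \<open>Extremality speaks of sums of two vectors; the induction extends it to one summand per
  coordinate. Scaling \<open>u $ j\<close> to \<open>0\<close> is left to
  \<open>extreme_rays_eq\<close>.\<close>

lemma extreme_generator_minimal:
  assumes A: "A \<in> rmax_mat p d" and B: "B \<in> rmax_mat p d" and d: "d \<ge> 1"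
    and u: "extreme_generator (ineq_cone A B) u"
  obtains j where "j < d" "u $ j \<noteq> -\<infinity>"
    "\<And>v. v \<in> ineq_cone A B \<Longrightarrow> v \<le> u \<Longrightarrow> v $ j = u $ j \<Longrightarrow> v = u"
proof -
  define V where "V = ineq_cone A B"
  have uV: "u \<in> V" and ur: "u \<in> rmax_vec d"
    using u ineq_cone_rmax[OF A] by (auto simp: extreme_generator_def V_def)
  note dim = rmax_vec_dim[OF ur]
  have "\<exists>j<d. u $ j \<noteq> -\<infinity> \<and> (\<forall>v\<in>V. v \<le> u \<and> v $ j = u $ j \<longrightarrow> v = u)"
  proof (rule ccontr)
    assume "\<not> ?thesis"
    then have ex: "\<exists>v\<in>V. v \<le> u \<and> v $ j = u $ j \<and> v \<noteq> u" if "j < d" "u $ j \<noteq> -\<infinity>" for j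
      using that by blast
    \<comment> \<open>Otherwise \<open>u\<close> is the tropical sum of cone elements strictly below it, one for each \<open>j\<close>.\<close>
    have "\<exists>v\<in>V. v \<le> u \<and> v \<noteq> u \<and> (\<forall>j<n. v $ j = u $ j)" if "n \<le> d" for n
      using that
    proof (induction n)
      case 0
      have "trop_zero_vec d \<le> u" "trop_zero_vec d \<noteq> u"
        using u dim by (auto simp: less_eq_vec_def trop_zero_vec_def extreme_generator_def)
      then show ?case using trop_zero_vec_in_cone[OF A B d] by (auto simp: V_def)
    next
      case (Suc n)
      then obtain v where v: "v \<in> V" "v \<le> u" "v \<noteq> u" "\<forall>j<n. v $ j = u $ j" by auto
      show ?case
      \<comment> \<open>Where \<open>u\<close> is \<open>-\<infinity>\<close>, everything below
        \<open>u\<close> agrees with it already; elsewhere a further summand \<open>w\<close>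
        restores entry \<open>n\<close>.\<close>
      proof (cases "u $ n = -\<infinity>")
        case True
        then have "v $ n = u $ n"
          using less_eq_vec_indexD[OF v(2), of n] dim Suc.prems by simp
        then show ?thesis using v by (auto simp: less_Suc_eq)
      next
        case False
        then obtain w where w: "w \<in> V" "w \<le> u" "w $ n = u $ n" "w \<noteq> u"
          using ex[of n] Suc.prems by auto
        have le: "v $ l \<le> u $ l" "w $ l \<le> u $ l" if "l < d" for l
          using that dim less_eq_vec_indexD v(2) w(2) by auto
        have dimv: "dim_vec v = d" using less_eq_vec_dimD[OF v(2)] dim by simp
        have idx: "trop_add_vec v w $ l = max (v $ l) (w $ l)" if "l < d" for l
          using that dimv by (simp add: trop_add_vec_def)
        have "trop_add_vec v w \<in> V" using v(1) w(1) trop_add_vec_in_cone[OF A d] by (simp add: V_def)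
        moreover have "trop_add_vec v w \<le> u"
          using le idx dim dimv by (auto simp: less_eq_vec_def trop_add_vec_def)
        \<comment> \<open>By extremality the sum cannot be \<open>u\<close>, since neither summand
          is.\<close>
        moreover have "trop_add_vec v w \<noteq> u"
          using u v(1,3) w(1,4) by (metis V_def extreme_generator_def)
        moreover have "trop_add_vec v w $ l = u $ l" if "l < Suc n" for l
          using that v(4) w(3) le[of l] Suc.prems by (auto simp: idx less_Suc_eq max_def)
        ultimately show ?thesis by blast
      qed
    qed
    then obtain v where "v \<le> u" "v \<noteq> u" "\<forall>j<d. v $ j = u $ j" by blast
    then show False using dim by (auto simp: less_eq_vec_def)
  qed
  then show thesis using that by (auto simp: V_def)
qed

section \<open>Rays, their representatives and their number\<close>

lemma trop_ray_smult: "trop_ray (trop_smult_vec (ereal c) u) = trop_ray u"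
proof -
  have scale: "trop_smult_vec a (trop_smult_vec (ereal c) u) = trop_smult_vec (a + ereal c) u" for a
    by (auto simp: trop_smult_vec_def add.assoc)
  show ?thesis
  proof (intro equalityI subsetI)
    fix x assume "x \<in> trop_ray (trop_smult_vec (ereal c) u)"
    then obtain a where "a \<in> rmax" "x = trop_smult_vec (a + ereal c) u"
      by (auto simp: trop_ray_def scale)
    then show "x \<in> trop_ray u" by (auto simp: trop_ray_def rmax_def)
  next
    fix x assume "x \<in> trop_ray u"
    then obtain a where a: "a \<in> rmax" "x = trop_smult_vec a u" by (auto simp: trop_ray_def)
    have "a = (a - ereal c) + ereal c" by (cases a) auto
    then have "x = trop_smult_vec (a - ereal c) (trop_smult_vec (ereal c) u)"
      using scale a(2) by simp
    then show "x \<in> trop_ray (trop_smult_vec (ereal c) u)"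
      using a(1) by (cases a) (auto simp: trop_ray_def rmax_def)
  qed
qed

text \<open>The only possible scalar is \<open>u $ i\<close>, read off where \<open>v\<close> is
  \<open>0\<close>. In this form equality of rays is a system of equations between entries, which
  suits passing to limits.\<close>

lemma trop_ray_eq_iff:
  assumes u: "u \<in> rmax_vec d" "j < d" "u $ j = 0" and v: "v \<in> rmax_vec d" "i < d" "v $ i = 0"
  shows "trop_ray u = trop_ray v \<longleftrightarrow> (\<forall>l<d. u $ l = u $ i + v $ l)"
proof
  note dim = rmax_vec_dim[OF u(1)] rmax_vec_dim[OF v(1)]
  assume eq: "trop_ray u = trop_ray v"
  have "u = trop_smult_vec 0 u" by (auto simp: trop_smult_vec_def)
  then have "u \<in> trop_ray v" unfolding eq[symmetric] by (auto simp: trop_ray_def rmax_def)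
  then obtain c where c: "u = trop_smult_vec c v" by (auto simp: trop_ray_def)
  have "u $ l = c + v $ l" if "l < d" for l
    using that dim by (subst c) (simp add: trop_smult_vec_def)
  then show "\<forall>l<d. u $ l = u $ i + v $ l" using v by simp
next
  note dim = rmax_vec_dim[OF u(1)] rmax_vec_dim[OF v(1)]
  assume eq: "\<forall>l<d. u $ l = u $ i + v $ l"
  \<comment> \<open>The case \<open>l = j\<close> shows that the scalar \<open>u $ i\<close> is
    finite, hence invertible.\<close>
  then have "u $ i + v $ j = 0" using u by simp
  then obtain c where c: "u $ i = ereal c"
    using rmax_vec_less_top[OF u(1) v(2)] rmax_vec_less_top[OF v(1) u(2)] by (cases "u $ i"; cases "v $ j") auto
  have "u = trop_smult_vec c v"
    using dim eq c by (auto simp: trop_smult_vec_def)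
  then show "trop_ray u = trop_ray v" by (simp add: trop_ray_smult)
qed

lemma extreme_rays_eq:
  assumes A: "A \<in> rmax_mat p d" and B: "B \<in> rmax_mat p d" and d: "d \<ge> 1"
  shows "extreme_rays (ineq_cone A B) =
    {trop_ray u | u j. j < d \<and> minimal_generator (ineq_cone A B) j u}"
proof (intro equalityI subsetI)
  fix R assume "R \<in> extreme_rays (ineq_cone A B)"
  then obtain u where R: "R = trop_ray u" and u: "extreme_generator (ineq_cone A B) u"
    by (auto simp: extreme_rays_def)
  have uV: "u \<in> ineq_cone A B" and ur: "u \<in> rmax_vec d"
    using u ineq_cone_rmax[OF A] by (auto simp: extreme_generator_def)
  obtain j where j: "j < d" "u $ j \<noteq> -\<infinity>"
    and min: "\<And>v. v \<in> ineq_cone A B \<Longrightarrow> v \<le> u \<Longrightarrow> v $ j = u $ j \<Longrightarrow> v = u"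
    using extreme_generator_minimal[OF A B d u] by blast
  obtain c where c: "u $ j = ereal c"
    using j rmax_vec_less_top[OF ur] by (cases "u $ j") auto
  define w where "w = trop_smult_vec (- c) u"
  have w_idx: "w $ l = - c + u $ l" if "l < d" for l
    using that ur by (simp add: w_def trop_smult_vec_def rmax_vec_dim)
  have wV: "w \<in> ineq_cone A B" using trop_smult_vec_in_cone[OF A d uV] by (simp add: w_def rmax_def)
  note wr = ineq_cone_rmax[OF A wV]
  have scale_w: "trop_smult_vec c w = u"
  proof (rule eq_vecI)
    show dims: "dim_vec (trop_smult_vec (ereal c) w) = dim_vec u"
      using wr ur by (simp add: trop_smult_vec_def rmax_vec_dim)
    fix l assume "l < dim_vec u"
    then have "l < d" using ur by (simp add: rmax_vec_dim)
    moreover have "ereal c + (ereal (- c) + u $ l) = u $ l" by (cases "u $ l") auto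
    ultimately show "trop_smult_vec (ereal c) w $ l = u $ l"
      using wr by (simp add: trop_smult_vec_def rmax_vec_dim w_idx)
  qed
  \<comment> \<open>Scaling back by \<open>c\<close> carries a competitor \<open>v\<close> below
    \<open>w\<close> to one below \<open>u\<close> with the same \<open>j\<close>-th entry as
    \<open>u\<close>, where \<open>min\<close> applies.\<close>
  have "v = w" if v: "v \<in> ineq_cone A B" "v \<le> w" "v $ j = 0" for v
  proof -
    have vr: "v \<in> rmax_vec d" using ineq_cone_rmax[OF A v(1)] .
    have v_idx: "trop_smult_vec c v $ l = c + v $ l" if "l < d" for l
      using that vr by (simp add: trop_smult_vec_def rmax_vec_dim)
    have "trop_smult_vec c v \<le> trop_smult_vec c w"
      using v(2) wr vr
      by (auto simp: less_eq_vec_def trop_smult_vec_def rmax_vec_dim intro!: add_left_mono)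
    then have eq: "trop_smult_vec c v = trop_smult_vec c w"
      using min[of "trop_smult_vec c v"] trop_smult_vec_in_cone[OF A d v(1), of "ereal c"]
        v(3) v_idx[OF j(1)] c scale_w by (simp add: rmax_def)
    have "v $ l = w $ l" if "l < d" for l
    proof -
      have "ereal c + v $ l = ereal c + w $ l"
        using arg_cong[OF eq, of "\<lambda>x. x $ l"] that vr wr by (simp add: trop_smult_vec_def rmax_vec_dim)
      then show ?thesis by (cases "v $ l"; cases "w $ l") auto
    qed
    then show ?thesis using vr wr by (intro eq_vecI) (auto simp: rmax_vec_dim)
  qed
  moreover have "w $ j = 0" using w_idx[OF j(1)] c by simp
  ultimately have w_min: "minimal_generator (ineq_cone A B) j w"
    using wV by (auto simp: minimal_generator_def)
  have "trop_ray w = R" by (simp add: w_def R trop_ray_smult)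
  then show "R \<in> {trop_ray u | u j. j < d \<and> minimal_generator (ineq_cone A B) j u}"
    using w_min j(1) by blast
next
  fix R assume "R \<in> {trop_ray u | u j. j < d \<and> minimal_generator (ineq_cone A B) j u}"
  then show "R \<in> extreme_rays (ineq_cone A B)"
    using minimal_generator_extreme[OF A] unfolding extreme_rays_def by blast
qed

text \<open>The bound, at most one ray per pair of \<open>j\<close> and \<open>f\<close>, depends on
  \<open>p\<close> and \<open>d\<close> only. This is why a maximum over all pairs of matrices
  exists.\<close>

lemma extreme_rays_finite_card_le:
  assumes A: "A \<in> rmax_mat p d" and B: "B \<in> rmax_mat p d" and d: "d \<ge> 1"
  shows "finite (extreme_rays (ineq_cone A B))" "card (extreme_rays (ineq_cone A B)) \<le> d * d ^ p"
proof -
  let ?r = "\<lambda>(j, f). trop_ray (cell_min A B f j)"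
  have sub: "extreme_rays (ineq_cone A B) \<subseteq> ?r ` ({..<d} \<times> choices p d)"
  proof
    fix R assume "R \<in> extreme_rays (ineq_cone A B)"
    then have "\<exists>u j. R = trop_ray u \<and> j < d \<and> minimal_generator (ineq_cone A B) j u"
      unfolding extreme_rays_eq[OF A B d] by simp
    then obtain j u where u: "R = trop_ray u" "j < d" "minimal_generator (ineq_cone A B) j u"
      by metis
    obtain f where "f \<in> choices p d" "u = cell_min A B f j"
      by (rule minimal_generator_eq_cell_min[OF A B u(2,3)])
    then show "R \<in> ?r ` ({..<d} \<times> choices p d)"
      using u(1,2) by (intro image_eqI[of _ _ "(j, f)"]) auto
  qed
  have fin: "finite ({..<d} \<times> choices p d)" by (simp add: finite_PiE)
  show "finite (extreme_rays (ineq_cone A B))" using finite_subset[OF sub] fin by simp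
  have "card (extreme_rays (ineq_cone A B)) \<le> card ({..<d} \<times> choices p d)"
    using fin by (rule surj_card_le[OF _ sub])
  then show "card (extreme_rays (ineq_cone A B)) \<le> d * d ^ p"
    by (simp add: card_cartesian_product card_PiE)
qed

section \<open>Monotone relaxations\<close>

lemma tendsto_add_ereal_less_top:
  fixes f g :: "'a \<Rightarrow> ereal"
  assumes "(f \<longlongrightarrow> x) F" "(g \<longlongrightarrow> y) F" "x \<noteq> \<infinity>" "y \<noteq> \<infinity>"
    and fin: "\<And>n. f n \<noteq> \<infinity>" "\<And>n. g n \<noteq> \<infinity>"
  shows "((\<lambda>n. f n + g n) \<longlongrightarrow> x + y) F"
proof -
  \<comment> \<open>Negation reduces the claim to addition away from \<open>-\<infinity>\<close>,
    which is continuous. The identity fails for opposite infinities, hence the bounds on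
    \<open>f\<close> and \<open>g\<close> themselves.\<close>
  have neg: "- (- a + - b) = a + b" if "a \<noteq> \<infinity>" "b \<noteq> \<infinity>" for a b :: ereal
    using that by (cases a; cases b) auto
  have "((\<lambda>n. - f n + - g n) \<longlongrightarrow> - x + - y) F"
    using assms(1-4) by (intro tendsto_add_ereal_nonneg tendsto_intros) (auto simp: ereal_uminus_eq_reorder)
  then have "((\<lambda>n. - (- f n + - g n)) \<longlongrightarrow> - (- x + - y)) F"
    by (intro tendsto_intros)
  then show ?thesis using neg fin assms(3,4) by simp
qed

lemma eventually_neq_of_limits:
  fixes f g :: "'a \<Rightarrow> 'b::t2_space"
  assumes "(f \<longlongrightarrow> x) F" "(g \<longlongrightarrow> y) F" "x \<noteq> y"
  shows "\<forall>\<^sub>F n in F. f n \<noteq> g n"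
proof -
  obtain U W where "open U" "open W" "x \<in> U" "y \<in> W" "U \<inter> W = {}"
    using hausdorff[OF assms(3)] by blast
  then have "\<forall>\<^sub>F n in F. f n \<in> U" "\<forall>\<^sub>F n in F. g n \<in> W"
    using assms topological_tendstoD by blast+
  then show ?thesis
    by eventually_elim (use \<open>U \<inter> W = {}\<close> in auto)
qed

section \<open>Cells and extreme rays along a relaxation\<close>

lemma trop_cell_mono:
  assumes A: "A \<in> rmax_mat p d" and A': "A' \<in> rmax_mat p d" and f: "f \<in> choices p d"
    and le: "\<And>i l. i < p \<Longrightarrow> l < d \<Longrightarrow> A' $$ (i, l) \<le> A $$ (i, l)"
      "\<And>i l. i < p \<Longrightarrow> l < d \<Longrightarrow> B $$ (i, l) \<le> B' $$ (i, l)"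
  shows "trop_cell A B f \<subseteq> trop_cell A' B' f"
proof
  fix x assume x: "x \<in> trop_cell A B f"
  have "A' $$ (i, l) + x $ l \<le> B' $$ (i, f i) + x $ f i" if "i < p" "l < d" for i l
  proof -
    have "f i < d" using f that(1) by auto
    have "A' $$ (i, l) + x $ l \<le> A $$ (i, l) + x $ l" using le(1) that by (intro add_right_mono)
    also have "\<dots> \<le> B $$ (i, f i) + x $ f i"
      using x that by (simp add: trop_cell_def rmax_mat_dim[OF A])
    also have "\<dots> \<le> B' $$ (i, f i) + x $ f i"
      using le(2) that(1) \<open>f i < d\<close> by (intro add_right_mono)
    finally show ?thesis .
  qed
  then show "x \<in> trop_cell A' B' f"
    using x by (simp add: trop_cell_def rmax_mat_dim[OF A] rmax_mat_dim[OF A'])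
qed

text \<open>As \<open>k\<close> grows, left entries increase and right entries decrease, so the
  cells shrink while containing those of the limit pair; their least points increase.\<close>

locale relaxation =
  fixes p d :: nat and A B :: "ereal mat" and As Bs :: "nat \<Rightarrow> ereal mat"
  assumes d: "d \<ge> 1"
    and A: "A \<in> rmax_mat p d" and B: "B \<in> rmax_mat p d"
    and As: "As k \<in> rmax_mat p d" and Bs: "Bs k \<in> rmax_mat p d"
    and As_inc: "i < p \<Longrightarrow> l < d \<Longrightarrow> incseq (\<lambda>k. As k $$ (i, l))"
    and Bs_dec: "i < p \<Longrightarrow> l < d \<Longrightarrow> decseq (\<lambda>k. Bs k $$ (i, l))"
    and As_lim: "i < p \<Longrightarrow> l < d \<Longrightarrow> (\<lambda>k. As k $$ (i, l)) \<longlonglongrightarrow> A $$ (i, l)"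
    and Bs_lim: "i < p \<Longrightarrow> l < d \<Longrightarrow> (\<lambda>k. Bs k $$ (i, l)) \<longlonglongrightarrow> B $$ (i, l)"
begin

abbreviation V where "V \<equiv> ineq_cone A B"
abbreviation Vs where "Vs k \<equiv> ineq_cone (As k) (Bs k)"
abbreviation m where "m k f j \<equiv> cell_min (As k) (Bs k) f j"

lemma V_subset_Vs: "V \<subseteq> Vs k"
proof -
  have "trop_cell A B f \<subseteq> trop_cell (As k) (Bs k) f" if "f \<in> choices p d" for f
    using that incseq_le[OF As_inc As_lim] decseq_ge[OF Bs_dec Bs_lim] by (intro trop_cell_mono[OF A As])
  then show ?thesis
    unfolding ineq_cone_eq_Union_cells[OF A d] ineq_cone_eq_Union_cells[OF As d] by (rule UN_mono[OF subset_refl])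
qed

lemma incseq_m:
  assumes f: "f \<in> choices p d" and l: "l < d"
  shows "incseq (\<lambda>k. m k f j $ l)"
proof (rule monoI, goal_cases)
  case (1 k k')
  have "trop_cell (As k') (Bs k') f \<subseteq> trop_cell (As k) (Bs k) f"
    using incseqD[OF As_inc 1] decseqD[OF Bs_dec 1] by (intro trop_cell_mono[OF As As f])
  then show ?case
    using l by (auto simp: cell_min_def rmax_mat_dim[OF As] intro!: INF_superset_mono)
qed

text \<open>The bound \<open>u\<close> keeps the increasing least points and their limit away from
  \<open>\<infinity>\<close>. There addition is continuous, so each inequality of the cell passes to
  the limit.\<close>

lemma m_limit:
  assumes f: "f \<in> choices p d" and j: "j < d" and u: "u \<in> rmax_vec d"
    and le: "\<And>k. m k f j \<le> u"
  obtains w where "w \<in> V" "w $ j = 0" "w \<le> u" "\<forall>l<d. (\<lambda>k. m k f j $ l) \<longlonglongrightarrow> w $ l"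
proof -
  define w where "w = vec d (\<lambda>l. SUP k. m k f j $ l)"
  have lim: "(\<lambda>k. m k f j $ l) \<longlonglongrightarrow> w $ l" if "l < d" for l
    using LIMSEQ_SUP[OF incseq_m[OF f that]] that by (simp add: w_def)
  have le_u: "m k f j $ l \<le> u $ l" if "l < d" for k l
    using le that less_eq_vec_indexD rmax_vec_dim[OF u] by blast
  have w_le: "w \<le> u"
    using le_u rmax_vec_dim[OF u] by (auto simp: less_eq_vec_def w_def intro!: SUP_least)
  have wr: "w \<in> rmax_vec d" by (rule rmax_vec_le[OF w_le u])
  have mr: "m k f j \<in> rmax_vec d" for k by (rule rmax_vec_le[OF le u])
  note mem = cell_min_mem[OF As Bs f j mr]
  have "A $$ (i, l) + w $ l \<le> B $$ (i, f i) + w $ f i" if i: "i < p" and l: "l < d" for i l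
  proof -
    have fi: "f i < d" using f i by auto
    note fin = rmax_mat_less_top[OF A i l] rmax_mat_less_top[OF As i l] rmax_mat_less_top[OF B i fi]
      rmax_mat_less_top[OF Bs i fi] rmax_vec_less_top[OF wr] rmax_vec_less_top[OF mr]
    have "(\<lambda>k. As k $$ (i, l) + m k f j $ l) \<longlonglongrightarrow> A $$ (i, l) + w $ l"
      using fin l by (intro tendsto_add_ereal_less_top As_lim lim i l) auto
    moreover have "(\<lambda>k. Bs k $$ (i, f i) + m k f j $ f i) \<longlonglongrightarrow> B $$ (i, f i) + w $ f i"
      using fin fi by (intro tendsto_add_ereal_less_top Bs_lim lim i fi) auto
    moreover have "As k $$ (i, l) + m k f j $ l \<le> Bs k $$ (i, f i) + m k f j $ f i" for k
      using mem(1)[of k] i l by (simp add: trop_cell_def rmax_mat_dim[OF As])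
    ultimately show ?thesis by (intro LIMSEQ_le) auto
  qed
  then have "w \<in> trop_cell A B f"
    using wr by (simp add: trop_cell_def rmax_mat_dim[OF A])
  then have "w \<in> V" using f unfolding ineq_cone_eq_Union_cells[OF A d] by (rule UN_I[rotated])
  moreover have "w $ j = 0"
    using LIMSEQ_unique[OF lim[OF j]] mem(2) by simp
  ultimately show thesis using that w_le lim by blast
qed

text \<open>By monotonicity, a least point that fails to be below \<open>u\<close> fails for all
  later \<open>k\<close>. If it never fails, the limit is a cone element below \<open>u\<close> with
  \<open>j\<close>-th entry \<open>0\<close>, which minimality identifies with
  \<open>u\<close>.\<close>

lemma eventually_m_not_le_or_limit:
  assumes u: "minimal_generator V j u" and f: "f \<in> choices p d" and j: "j < d"
  shows "(\<forall>\<^sub>F k in sequentially. \<not> m k f j \<le> u) \<or>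
    (\<forall>k. m k f j \<le> u) \<and> (\<forall>l<d. (\<lambda>k. m k f j $ l) \<longlonglongrightarrow> u $ l)"
proof (cases "\<forall>k. m k f j \<le> u")
  case True
  have ur: "u \<in> rmax_vec d" using u ineq_cone_rmax[OF A] by (auto simp: minimal_generator_def)
  obtain w where w: "w \<in> V" "w $ j = 0" "w \<le> u" "\<forall>l<d. (\<lambda>k. m k f j $ l) \<longlonglongrightarrow> w $ l"
    by (rule m_limit[OF f j ur True[rule_format]])
  then have "w = u" using u by (auto simp: minimal_generator_def)
  then show ?thesis using w(4) True by simp
next
  case False
  then obtain k where k: "\<not> m k f j \<le> u" by blast
  have "\<not> m k' f j \<le> u" if "k \<le> k'" for k'
  proof
    assume "m k' f j \<le> u"
    moreover have "m k f j \<le> m k' f j"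
      using incseqD[OF incseq_m[OF f] that]
      by (auto simp: less_eq_vec_def cell_min_def rmax_mat_dim[OF As])
    ultimately show False using k by simp
  qed
  then show ?thesis by (auto simp: eventually_sequentially)
qed

text \<open>If both least points stay bounded, they converge to \<open>u\<close> and
  \<open>v\<close>. Some equation of \<open>trop_ray_eq_iff\<close> fails in the limit, and both its
  sides converge, so it fails for large \<open>k\<close>.\<close>

lemma eventually_distinct_rays:
  assumes u: "minimal_generator V j u" "j < d" and v: "minimal_generator V i v" "i < d"
    and f: "f \<in> choices p d" and g: "g \<in> choices p d" and ne: "trop_ray u \<noteq> trop_ray v"
  shows "\<forall>\<^sub>F k in sequentially. m k f j \<le> u \<longrightarrow> m k g i \<le> v \<longrightarrow> trop_ray (m k f j) \<noteq> trop_ray (m k g i)"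
proof -
  have ur: "u \<in> rmax_vec d" "u $ j = 0" and vr: "v \<in> rmax_vec d" "v $ i = 0"
    using u v ineq_cone_rmax[OF A] by (auto simp: minimal_generator_def)
  consider "\<forall>\<^sub>F k in sequentially. \<not> m k f j \<le> u" | "\<forall>\<^sub>F k in sequentially. \<not> m k g i \<le> v"
    | "\<forall>k. m k f j \<le> u" "\<forall>k. m k g i \<le> v" "\<forall>l<d. (\<lambda>k. m k f j $ l) \<longlonglongrightarrow> u $ l" "\<forall>l<d. (\<lambda>k. m k g i $ l) \<longlonglongrightarrow> v $ l"
    using eventually_m_not_le_or_limit[OF u(1) f u(2)] eventually_m_not_le_or_limit[OF v(1) g v(2)] by blast
  then show ?thesis
  proof cases
    case 1
    then show ?thesis by eventually_elim simp
  next
    case 2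
    then show ?thesis by eventually_elim simp
  next
    case 3
    obtain l where l: "l < d" "u $ l \<noteq> u $ i + v $ l"
      using ne trop_ray_eq_iff[OF ur(1) u(2) ur(2) vr(1) v(2) vr(2)] by blast
    have mr: "m k f j \<in> rmax_vec d" "m k g i \<in> rmax_vec d" for k
      using rmax_vec_le 3(1,2) ur(1) vr(1) by blast+
    have "(\<lambda>k. m k f j $ i + m k g i $ l) \<longlonglongrightarrow> u $ i + v $ l"
      using 3(3,4) l(1) v(2) rmax_vec_less_top[OF ur(1)] rmax_vec_less_top[OF vr(1)]
        rmax_vec_less_top[OF mr(1)] rmax_vec_less_top[OF mr(2)]
      by (intro tendsto_add_ereal_less_top) auto
    moreover have "(\<lambda>k. m k f j $ l) \<longlonglongrightarrow> u $ l" using 3(3) l(1) by simp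
    ultimately have "\<forall>\<^sub>F k in sequentially. m k f j $ l \<noteq> m k f j $ i + m k g i $ l"
      using l(2) by (intro eventually_neq_of_limits)
    then show ?thesis
    proof eventually_elim
      case (elim k)
      then show ?case
        using trop_ray_eq_iff[OF mr(1) u(2) _ mr(2) v(2)] l(1)
          cell_min_mem(2)[OF As Bs f u(2) mr(1)] cell_min_mem(2)[OF As Bs g v(2) mr(2)] by blast
    qed
  qed
qed

text \<open>Each extreme ray \<open>R\<close> of \<open>V\<close> is sent to the ray of a minimal
  generator of \<open>Vs k\<close> below its representative \<open>U R\<close>; for large
  \<open>k\<close> this map is injective.\<close>

lemma eventually_card_extreme_rays_le:
  "\<forall>\<^sub>F k in sequentially. card (extreme_rays V) \<le> card (extreme_rays (Vs k))"
proof -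
  define E where "E = extreme_rays V"
  have finE: "finite E" unfolding E_def by (rule extreme_rays_finite_card_le[OF A B d])
  have "\<exists>u j. R = trop_ray u \<and> j < d \<and> minimal_generator V j u" if "R \<in> E" for R
    using that unfolding E_def extreme_rays_eq[OF A B d] by simp
  then obtain U J where UJ: "\<And>R. R \<in> E \<Longrightarrow> R = trop_ray (U R) \<and> J R < d \<and> minimal_generator V (J R) (U R)"
    by metis
  have "\<exists>f. f \<in> choices p d \<and> minimal_generator (Vs k) (J R) (m k f (J R)) \<and> m k f (J R) \<le> U R"
    if R: "R \<in> E" for k R
  proof -
    have "U R \<in> Vs k" "U R $ J R = 0"
      using UJ[OF R] V_subset_Vs by (auto simp: minimal_generator_def)
    then show ?thesis
      using minimal_generator_below[OF As Bs] UJ[OF R] by metis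
  qed
  then have "\<forall>k R. \<exists>f. R \<in> E \<longrightarrow> f \<in> choices p d \<and>
      minimal_generator (Vs k) (J R) (m k f (J R)) \<and> m k f (J R) \<le> U R"
    by blast
  then obtain \<phi> where \<phi>: "\<And>k R. R \<in> E \<Longrightarrow> \<phi> k R \<in> choices p d \<and>
      minimal_generator (Vs k) (J R) (m k (\<phi> k R) (J R)) \<and> m k (\<phi> k R) (J R) \<le> U R"
    unfolding choice_iff by blast
  have finC: "finite (choices p d)" by (simp add: finite_PiE)
  \<comment> \<open>The cell chosen for \<open>R\<close> may change with \<open>k\<close>, so the
    rays are separated for all \<open>f\<close> and \<open>g\<close> at once; finiteness gives a
    common threshold.\<close>
  have "\<forall>\<^sub>F k in sequentially. \<forall>R\<in>E. \<forall>S\<in>E. \<forall>f\<in>choices p d. \<forall>g\<in>choices p d. R \<noteq> S \<longrightarrow>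
      m k f (J R) \<le> U R \<longrightarrow> m k g (J S) \<le> U S \<longrightarrow> trop_ray (m k f (J R)) \<noteq> trop_ray (m k g (J S))"
  proof (intro eventually_ball_finite finE finC ballI)
    fix R S f g
    assume *: "R \<in> E" "S \<in> E" "f \<in> choices p d" "g \<in> choices p d"
    show "\<forall>\<^sub>F k in sequentially. R \<noteq> S \<longrightarrow> m k f (J R) \<le> U R \<longrightarrow> m k g (J S) \<le> U S \<longrightarrow>
        trop_ray (m k f (J R)) \<noteq> trop_ray (m k g (J S))"
    proof (cases "R = S")
      case False
      then have "trop_ray (U R) \<noteq> trop_ray (U S)" using UJ[OF *(1)] UJ[OF *(2)] by metis
      then show ?thesis
        using eventually_distinct_rays[OF _ _ _ _ *(3,4)] UJ[OF *(1)] UJ[OF *(2)] False by simp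
    qed simp
  qed
  then show ?thesis
  proof eventually_elim
    case (elim k)
    have "inj_on (\<lambda>R. trop_ray (m k (\<phi> k R) (J R))) E"
    proof (rule inj_onI, rule ccontr)
      fix R S assume *: "R \<in> E" "S \<in> E" "R \<noteq> S"
        "trop_ray (m k (\<phi> k R) (J R)) = trop_ray (m k (\<phi> k S) (J S))"
      show False using elim * \<phi>[OF *(1), of k] \<phi>[OF *(2), of k] by blast
    qed
    moreover have "(\<lambda>R. trop_ray (m k (\<phi> k R) (J R))) ` E \<subseteq> extreme_rays (Vs k)"
      unfolding extreme_rays_eq[OF As Bs d] using \<phi> UJ by blast
    ultimately have "card E \<le> card (extreme_rays (Vs k))"
      using extreme_rays_finite_card_le(1)[OF As Bs d] by (rule card_inj_on_le)
    then show ?case by (simp add: E_def)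
  qed
qed

end

section \<open>Generic relaxations\<close>

definition left_part :: "ereal mat \<Rightarrow> ereal mat \<Rightarrow> ereal mat" where
  "left_part A B = mat (dim_row A) (dim_col A)
     (\<lambda>e. if B $$ e < A $$ e then A $$ e else -\<infinity>)"

definition right_part :: "ereal mat \<Rightarrow> ereal mat \<Rightarrow> ereal mat" where
  "right_part A B = mat (dim_row A) (dim_col A)
     (\<lambda>e. if B $$ e < A $$ e then -\<infinity> else B $$ e)"

lemma left_part_rmax: "A \<in> rmax_mat p d \<Longrightarrow> left_part A B \<in> rmax_mat p d"
  by (auto simp: rmax_mat_def left_part_def rmax_def split: if_splits)

lemma right_part_rmax: "A \<in> rmax_mat p d \<Longrightarrow> B \<in> rmax_mat p d \<Longrightarrow> right_part A B \<in> rmax_mat p d"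
  by (auto simp: rmax_mat_def right_part_def rmax_def split: if_splits)

text \<open>A left entry at most the right one in its position never breaks an inequality. When the
  inequality holds, a right entry below the left one cannot attain the right maximum unless that is
  \<open>-\<infinity>\<close>: the left term in its position would exceed it.\<close>

lemma ineq_cone_parts:
  assumes A: "A \<in> rmax_mat p d" and B: "B \<in> rmax_mat p d" and d: "d \<ge> 1"
  shows "ineq_cone (left_part A B) (right_part A B) = ineq_cone A B"
proof -
  let ?L = "left_part A B" and ?R = "right_part A B"
  have L: "?L $$ (i, l) = (if B $$ (i, l) < A $$ (i, l) then A $$ (i, l) else -\<infinity>)"
    and R: "?R $$ (i, l) = (if B $$ (i, l) < A $$ (i, l) then -\<infinity> else B $$ (i, l))"
    if "i < p" "l < d" for i l
    using that by (simp_all add: left_part_def right_part_def rmax_mat_dim[OF A])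
  have row: "(\<exists>b<d. \<forall>l<d. ?L $$ (i, l) + x $ l \<le> ?R $$ (i, b) + x $ b) \<longleftrightarrow>
      (\<exists>b<d. \<forall>l<d. A $$ (i, l) + x $ l \<le> B $$ (i, b) + x $ b)"
    if x: "x \<in> rmax_vec d" and i: "i < p" for x i
  proof
    assume "\<exists>b<d. \<forall>l<d. ?L $$ (i, l) + x $ l \<le> ?R $$ (i, b) + x $ b"
    then obtain b where b: "b < d" "\<And>l. l < d \<Longrightarrow> ?L $$ (i, l) + x $ l \<le> ?R $$ (i, b) + x $ b"
      by blast
    \<comment> \<open>The index \<open>b\<close> handles only the left entries that are kept; an
      index \<open>c\<close> maximising the original right-hand side also handles the discarded
      ones.\<close>
    let ?S = "(\<lambda>l. B $$ (i, l) + x $ l) ` {..<d}"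
    have "finite ?S" "?S \<noteq> {}" using b(1) by auto
    then obtain c where c: "c < d" "Max ?S = B $$ (i, c) + x $ c" using Max_in by blast
    have max: "B $$ (i, l) + x $ l \<le> B $$ (i, c) + x $ c" if "l < d" for l
      unfolding c(2)[symmetric] using that by (intro Max_ge) auto
    have "A $$ (i, l) + x $ l \<le> B $$ (i, c) + x $ c" if l: "l < d" for l
    proof (cases "B $$ (i, l) < A $$ (i, l)")
      case True
      then have "A $$ (i, l) + x $ l \<le> ?R $$ (i, b) + x $ b" using b(2)[OF l] L[OF i l] by simp
      also have "\<dots> \<le> B $$ (i, b) + x $ b"
        using R[OF i b(1)] by (intro add_right_mono) auto
      finally show ?thesis using max[OF b(1)] by (rule order_trans)
    next
      case False
      then have "A $$ (i, l) + x $ l \<le> B $$ (i, l) + x $ l" by (intro add_right_mono) simp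
      then show ?thesis using max[OF l] by (rule order_trans)
    qed
    then show "\<exists>b<d. \<forall>l<d. A $$ (i, l) + x $ l \<le> B $$ (i, b) + x $ b" using c(1) by blast
  next
    assume "\<exists>b<d. \<forall>l<d. A $$ (i, l) + x $ l \<le> B $$ (i, b) + x $ b"
    then obtain b where b: "b < d" "\<And>l. l < d \<Longrightarrow> A $$ (i, l) + x $ l \<le> B $$ (i, b) + x $ b"
      by blast
    note xb = rmax_vec_less_top[OF x b(1)] and Ab = rmax_mat_less_top[OF A i b(1)]
      and Bb = rmax_mat_less_top[OF B i b(1)]
    have "?L $$ (i, l) + x $ l \<le> ?R $$ (i, b) + x $ b" if l: "l < d" for l
    proof -
      have "?L $$ (i, l) \<le> A $$ (i, l)" using L[OF i l] by simp
      then have le: "?L $$ (i, l) + x $ l \<le> B $$ (i, b) + x $ b"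
        using b(2)[OF l] add_right_mono order_trans by blast
      show ?thesis
      proof (cases "B $$ (i, b) < A $$ (i, b)")
        case True
        \<comment> \<open>The discarded right term at \<open>b\<close> must be
          \<open>-\<infinity>\<close>; then so are all kept left terms, and \<open>b\<close> still
          serves as witness.\<close>
        have "B $$ (i, b) + x $ b = -\<infinity>"
        proof (rule ccontr)
          assume "B $$ (i, b) + x $ b \<noteq> -\<infinity>"
          then have "B $$ (i, b) + x $ b < A $$ (i, b) + x $ b"
            using True xb Ab Bb by (cases "B $$ (i, b)"; cases "x $ b"; cases "A $$ (i, b)") auto
          then show False using b(2)[OF b(1)] by simp
        qed
        then have "?L $$ (i, l) + x $ l \<le> -\<infinity>" using le by (simp only:)
        then show ?thesis by (rule order_trans) simp
      next
        case False
        then show ?thesis using le R[OF i b(1)] by simp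
      qed
    qed
    then show "\<exists>b<d. \<forall>l<d. ?L $$ (i, l) + x $ l \<le> ?R $$ (i, b) + x $ b" using b(1) by blast
  qed
  show ?thesis
    by (rule Set.set_eqI, unfold mem_ineq_cone_iff[OF left_part_rmax[OF A] d] mem_ineq_cone_iff[OF A d])
      (intro conj_cong refl all_cong row)
qed

section \<open>Perturbed pairs and their convergence\<close>

definition harm :: "nat \<Rightarrow> real" where
  "harm k = 1 / real (Suc k)"

text \<open>Injectivity of \<open>prod_encode\<close> gives different positions different exponents;
  \<open>Suc\<close> excludes exponent 0, for which the perturbation would not tend to 0.\<close>

abbreviation pert :: "nat \<Rightarrow> nat \<times> nat \<Rightarrow> real" where
  "pert k e \<equiv> harm k ^ Suc (prod_encode e)"

definition relax_left :: "ereal mat \<Rightarrow> ereal mat \<Rightarrow> nat \<Rightarrow> ereal mat" where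
  "relax_left A B k = mat (dim_row A) (dim_col A)
     (\<lambda>e. if B $$ e < A $$ e then ereal (real_of_ereal (A $$ e) - pert k e) else -\<infinity>)"

text \<open>Where both entries are \<open>-\<infinity>\<close>, the finite substitute goes to the
  right, since left entries increasing to \<open>-\<infinity>\<close> would be constant. Its main
  part \<open>- real (Suc k)\<close> is minus the reciprocal of \<open>harm k\<close>, so all finite
  entries are rational functions of one parameter.\<close>

definition relax_right :: "ereal mat \<Rightarrow> ereal mat \<Rightarrow> nat \<Rightarrow> ereal mat" where
  "relax_right A B k = mat (dim_row A) (dim_col A)
     (\<lambda>e. if B $$ e < A $$ e then -\<infinity>
        else if B $$ e = -\<infinity> then ereal (pert k e - real (Suc k))
        else ereal (real_of_ereal (B $$ e) + pert k e))"

lemma relax_rmax: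
  assumes "A \<in> rmax_mat p d"
  shows "relax_left A B k \<in> rmax_mat p d" "relax_right A B k \<in> rmax_mat p d"
  using assms by (auto simp: rmax_mat_def relax_left_def relax_right_def rmax_def split: if_splits)

lemma harm_pos: "0 < harm k" and harm_le_1: "harm k \<le> 1"
  by (simp_all add: harm_def)

lemma pert_mono: "k \<le> k' \<Longrightarrow> pert k' e \<le> pert k e"
  by (rule power_mono) (simp_all add: harm_def frac_le)

lemma pert_le_1: "pert k e \<le> 1"
  using power_mono[OF harm_le_1[of k], of "Suc (prod_encode e)"] harm_pos[of k] by simp

lemma pert_tendsto: "(\<lambda>k. pert k e) \<longlonglongrightarrow> 0"
proof -
  have "harm \<longlonglongrightarrow> 0"
    unfolding harm_def using LIMSEQ_inverse_real_of_nat by (simp add: inverse_eq_divide)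
  from tendsto_power[OF this, of "Suc (prod_encode e)"] show ?thesis by simp
qed

lemma relaxation_relax:
  assumes A: "A \<in> rmax_mat p d" and B: "B \<in> rmax_mat p d" and d: "d \<ge> 1"
  shows "relaxation p d (left_part A B) (right_part A B) (relax_left A B) (relax_right A B)"
proof
  fix i l assume i: "i < p" and l: "l < d"
  note dims = rmax_mat_dim[OF A]
  have real_A: "A $$ (i, l) = ereal (real_of_ereal (A $$ (i, l)))" if "B $$ (i, l) < A $$ (i, l)"
    using that rmax_mat_less_top[OF A i l] by (cases "A $$ (i, l)") auto
  have real_B: "B $$ (i, l) = ereal (real_of_ereal (B $$ (i, l)))" if "B $$ (i, l) \<noteq> -\<infinity>"
    using that rmax_mat_less_top[OF B i l] by (cases "B $$ (i, l)") auto
  let ?p = "\<lambda>k. pert k (i, l)"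
  show "incseq (\<lambda>k. relax_left A B k $$ (i, l))"
    using i l by (intro monoI) (auto simp: relax_left_def dims pert_mono simp del: power_Suc)
  show "decseq (\<lambda>k. relax_right A B k $$ (i, l))"
  proof (rule antimonoI)
    fix k k' :: nat assume "k \<le> k'"
    then show "relax_right A B k' $$ (i, l) \<le> relax_right A B k $$ (i, l)"
      using i l pert_mono[of k k' "(i, l)"] by (auto simp: relax_right_def dims simp del: power_Suc)
  qed
  show "(\<lambda>k. relax_left A B k $$ (i, l)) \<longlonglongrightarrow> left_part A B $$ (i, l)"
  proof (cases "B $$ (i, l) < A $$ (i, l)")
    case True
    have "(\<lambda>k. ereal (real_of_ereal (A $$ (i, l)) - ?p k)) \<longlonglongrightarrow> ereal (real_of_ereal (A $$ (i, l)) - 0)"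
      by (intro tendsto_intros pert_tendsto)
    then show ?thesis
      using i l True real_A by (simp add: relax_left_def left_part_def dims del: power_Suc)
  qed (use i l in \<open>simp add: relax_left_def left_part_def dims\<close>)
  show "(\<lambda>k. relax_right A B k $$ (i, l)) \<longlonglongrightarrow> right_part A B $$ (i, l)"
  proof -
    consider "B $$ (i, l) < A $$ (i, l)" | "\<not> B $$ (i, l) < A $$ (i, l)" "B $$ (i, l) = -\<infinity>"
      | "\<not> B $$ (i, l) < A $$ (i, l)" "B $$ (i, l) \<noteq> -\<infinity>" by blast
    then show ?thesis
    proof cases
      case 1
      then show ?thesis using i l by (simp add: relax_right_def right_part_def dims)
    next
      case 2
      have "(\<lambda>k. ereal (?p k - real (Suc k))) \<longlonglongrightarrow> -\<infinity>"
        unfolding tendsto_MInfty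
      proof
        fix r
        \<comment> \<open>The entry is at most \<open>- real k\<close>, because the perturbation is
          at most 1.\<close>
        have "\<forall>\<^sub>F k in sequentially. - r < real k"
          using filterlim_real_sequentially by (simp add: filterlim_at_top_dense)
        then show "\<forall>\<^sub>F k in sequentially. ereal (?p k - real (Suc k)) < ereal r"
        proof eventually_elim
          case (elim k)
          then show ?case using pert_le_1[of k "(i, l)"] by (simp del: power_Suc)
        qed
      qed
      then show ?thesis
        using i l 2 by (simp add: relax_right_def right_part_def dims del: power_Suc of_nat_Suc)
    next
      case 3
      have "(\<lambda>k. ereal (real_of_ereal (B $$ (i, l)) + ?p k)) \<longlonglongrightarrow> ereal (real_of_ereal (B $$ (i, l)) + 0)"
        by (intro tendsto_intros pert_tendsto)
      then show ?thesis
        using i l 3 real_B by (simp add: relax_right_def right_part_def dims del: power_Suc)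
    qed
  qed
qed (use assms left_part_rmax right_part_rmax relax_rmax in auto)

section \<open>General position of the perturbed pairs\<close>

lemma trop_nonsingularI:
  assumes M: "M \<in> carrier_mat n n"
    and real: "\<And>i j. i < n \<Longrightarrow> j < n \<Longrightarrow> M $$ (i, j) = ereal (c i j)"
    and distinct: "\<And>\<sigma> \<tau>. \<sigma> permutes {..<n} \<Longrightarrow> \<tau> permutes {..<n} \<Longrightarrow> \<sigma> \<noteq> \<tau> \<Longrightarrow>
      (\<Sum>i<n. c i (\<sigma> i)) \<noteq> (\<Sum>i<n. c i (\<tau> i))"
  shows "trop_nonsingular M"
proof -
  let ?P = "{\<sigma>. \<sigma> permutes {..<n}}"
  have weight: "trop_weight M \<sigma> = ereal (\<Sum>i<n. c i (\<sigma> i))" if "\<sigma> \<in> ?P" for \<sigma>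
  proof -
    have "\<sigma> i < n" if "i < n" for i
      using permutes_in_image[of \<sigma> "{..<n}" i] \<open>\<sigma> \<in> ?P\<close> that by simp
    then have "trop_weight M \<sigma> = (\<Sum>i<n. ereal (c i (\<sigma> i)))"
      using M real unfolding trop_weight_def by (intro sum.cong) auto
    then show ?thesis by simp
  qed
  have "finite ?P" by (simp add: finite_permutations)
  moreover have "?P \<noteq> {}" using permutes_id by blast
  ultimately have "Max (trop_weight M ` ?P) \<in> trop_weight M ` ?P" by (intro Max_in) simp_all
  then have "trop_permanent M \<in> trop_weight M ` ?P"
    using M by (simp add: trop_permanent_def)
  then obtain \<sigma> where \<sigma>: "\<sigma> \<in> ?P" "trop_weight M \<sigma> = trop_permanent M" by auto
  have "\<tau> = \<sigma>" if "\<tau> \<in> ?P" "trop_weight M \<tau> = trop_permanent M" for \<tau>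
  proof -
    have "ereal (\<Sum>i<n. c i (\<tau> i)) = ereal (\<Sum>i<n. c i (\<sigma> i))"
      using that \<sigma> weight by metis
    then show ?thesis using distinct[of \<tau> \<sigma>] that(1) \<sigma>(1) by auto
  qed
  then have "\<exists>!\<sigma>. \<sigma> permutes {..<n} \<and> trop_weight M \<sigma> = trop_permanent M" using \<sigma> by auto
  moreover have "\<bar>trop_permanent M\<bar> \<noteq> \<infinity>" 
    unfolding \<sigma>(2)[symmetric] weight[OF \<sigma>(1)] by simp
  moreover have "dim_row M = n" "dim_col M = n" using M by auto
  ultimately show ?thesis unfolding trop_nonsingular_def by (simp only: not_False_eq_True simp_thms)
qed

text \<open>A permutation selects one position of \<open>C\<close> in each chosen row. Different
  permutations select different sets of positions, so distinct subset sums settle all square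
  submatrices at once.\<close>

lemma trop_nonsingular_submatrix:
  assumes C: "C \<in> carrier_mat p d" and I: "I \<subseteq> {..<p}" and J: "J \<subseteq> {..<d}" and card: "card I = card J"
    and real: "\<And>e. e \<in> {..<p} \<times> {..<d} \<Longrightarrow> C $$ e = ereal (c e)"
    and distinct: "\<And>E F. E \<subseteq> {..<p} \<times> {..<d} \<Longrightarrow> F \<subseteq> {..<p} \<times> {..<d} \<Longrightarrow> E \<noteq> F \<Longrightarrow> sum c E \<noteq> sum c F"
  shows "trop_nonsingular (submatrix C I J)"
proof -
  define n where "n = card I"
  have "{i. i < p \<and> i \<in> I} = I" "{j. j < d \<and> j \<in> J} = J" using I J by auto
  then have cards: "card {i. i < dim_row C \<and> i \<in> I} = n" "card {j. j < dim_col C \<and> j \<in> J} = n"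
    using C card by (auto simp: n_def)
  have pickI: "pick I i \<in> I" and pickJ: "pick J i \<in> J" if "i < n" for i
    using that card by (auto simp: n_def intro!: pick_in_set_le)
  \<comment> \<open>Both enumerations are strictly increasing below \<open>n\<close>, hence
    injective.\<close>
  have inj: "i = j" if "pick I i = pick I j \<or> pick J i = pick J j" "i < n" "j < n" for i j
  proof (rule ccontr)
    assume "i \<noteq> j"
    then consider "i < j" | "j < i" by linarith
    then show False
      using that pick_mono_le[of i I j] pick_mono_le[of j I i] pick_mono_le[of i J j]
        pick_mono_le[of j J i] card by cases (auto simp: n_def)
  qed
  show ?thesis
  proof (rule trop_nonsingularI)
    show "submatrix C I J \<in> carrier_mat n n"
      by (rule carrier_matI) (simp_all only: dim_submatrix cards)
    show "submatrix C I J $$ (i, j) = ereal (c (pick I i, pick J j))" if "i < n" "j < n" for i j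
    proof -
      have "(pick I i, pick J j) \<in> {..<p} \<times> {..<d}" using pickI[OF that(1)] pickJ[OF that(2)] I J by auto
      then show ?thesis using that by (subst submatrix_index) (simp_all only: cards real)
    qed
    fix \<sigma> \<tau> assume perm: "\<sigma> permutes {..<n}" "\<tau> permutes {..<n}" and ne: "\<sigma> \<noteq> \<tau>"
    let ?E = "\<lambda>\<sigma>. (\<lambda>i. (pick I i, pick J (\<sigma> i))) ` {..<n}"
    have lt: "\<sigma> i < n" "\<tau> i < n" if "i < n" for i
      using permutes_in_image[OF perm(1)] permutes_in_image[OF perm(2)] that by auto
    have sum: "(\<Sum>i<n. c (pick I i, pick J (\<rho> i))) = sum c (?E \<rho>)" for \<rho>
    proof -
      have "inj_on (\<lambda>i. (pick I i, pick J (\<rho> i))) {..<n}"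
      proof (rule inj_onI)
        fix i j assume "i \<in> {..<n}" "j \<in> {..<n}" "(pick I i, pick J (\<rho> i)) = (pick I j, pick J (\<rho> j))"
        then show "i = j" using inj[OF disjI1, of i j] by simp
      qed
      then show ?thesis by (simp add: sum.reindex)
    qed
    obtain i where i: "\<sigma> i \<noteq> \<tau> i" using ne by auto
    have "i < n" using i perm by (metis lessThan_iff permutes_not_in)
    \<comment> \<open>The set for \<open>\<tau>\<close> meets row \<open>pick I i\<close> only in
      column \<open>pick J (\<tau> i)\<close>.\<close>
    have "(pick I i, pick J (\<sigma> i)) \<notin> ?E \<tau>"
    proof
      assume "(pick I i, pick J (\<sigma> i)) \<in> ?E \<tau>"
      then obtain j where j: "j < n" "pick I i = pick I j" "pick J (\<sigma> i) = pick J (\<tau> j)" by auto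
      have "i = j" by (rule inj[OF disjI1[OF j(2)] \<open>i < n\<close> j(1)])
      then have "\<sigma> i = \<tau> i" using inj[OF disjI2[OF j(3)]] lt \<open>i < n\<close> by simp
      then show False using i by simp
    qed
    moreover have "(pick I i, pick J (\<sigma> i)) \<in> ?E \<sigma>" using \<open>i < n\<close> by blast
    ultimately have E_ne: "?E \<sigma> \<noteq> ?E \<tau>" by blast
    have sub: "?E \<rho> \<subseteq> {..<p} \<times> {..<d}" if "\<And>i. i < n \<Longrightarrow> \<rho> i < n" for \<rho>
    proof (rule image_subsetI)
      fix i assume "i \<in> {..<n}"
      then show "(pick I i, pick J (\<rho> i)) \<in> {..<p} \<times> {..<d}"
        using subsetD[OF I pickI[of i]] subsetD[OF J pickJ[OF that[of i]]] by simp
    qed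
    show "(\<Sum>i<n. c (pick I i, pick J (\<sigma> i))) \<noteq> (\<Sum>i<n. c (pick I i, pick J (\<tau> i)))"
      unfolding sum by (rule distinct[OF sub sub E_ne]) (erule lt)+
  qed
qed

text \<open>The entry of the relaxed pair at \<open>e\<close>, multiplied by \<open>t = harm k\<close>, as a polynomial in \<open>t\<close>.\<close>

definition entry_poly :: "ereal mat \<Rightarrow> ereal mat \<Rightarrow> nat \<times> nat \<Rightarrow> real poly" where
  "entry_poly A B e =
    (if B $$ e < A $$ e then [:0, real_of_ereal (A $$ e):] - monom 1 (Suc (Suc (prod_encode e)))
     else if B $$ e = -\<infinity> then [:-1:] + monom 1 (Suc (Suc (prod_encode e)))
     else [:0, real_of_ereal (B $$ e):] + monom 1 (Suc (Suc (prod_encode e))))"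

text \<open>Unperturbed parts have degree at most 1, and multiplication by \<open>t\<close> moves
  each perturbation to degree at least 2, where the exponent identifies the position.\<close>

lemma coeff_entry_poly:
  "coeff (entry_poly A B e) (Suc (Suc (prod_encode e'))) =
    (if e = e' then if B $$ e < A $$ e then -1 else 1 else 0)"
  by (auto simp: entry_poly_def)

text \<open>One coefficient tells whether \<open>e\<close> belongs to the set, so the sum determines
  the set.\<close>

lemma sum_entry_poly_distinct:
  assumes "finite E" "finite F" "E \<noteq> F"
  shows "sum (entry_poly A B) E \<noteq> sum (entry_poly A B) F"
proof -
  obtain e where e: "e \<in> E \<longleftrightarrow> e \<notin> F" using assms(3) by blast
  let ?s = "if B $$ e < A $$ e then -1 else 1 :: real"
  have "coeff (sum (entry_poly A B) G) (Suc (Suc (prod_encode e))) = (if e \<in> G then ?s else 0)"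
    if "finite G" for G
    using that by (simp add: coeff_sum coeff_entry_poly sum.delta cong: if_cong)
  from this[OF assms(1)] this[OF assms(2)] show ?thesis using e by (auto split: if_splits)
qed

text \<open>A nonzero polynomial has finitely many roots, and \<open>harm\<close> takes each of them
  at most once.\<close>

lemma eventually_poly_harm_nonzero:
  assumes "P \<noteq> (0 :: real poly)"
  shows "\<forall>\<^sub>F k in sequentially. poly P (harm k) \<noteq> 0"
proof -
  have "inj harm" by (auto simp: inj_def harm_def)
  then have "finite (harm -` {x. poly P x = 0})"
    using poly_roots_finite[OF assms] by (intro finite_vimageI)
  then show ?thesis
    unfolding cofinite_eq_sequentially[symmetric] eventually_cofinite by (simp add: vimage_def)
qed

lemma relax_entry:
  assumes A: "A \<in> rmax_mat p d" and e: "e \<in> {..<p} \<times> {..<d}"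
  shows "trop_add_mat (relax_left A B k) (relax_right A B k) $$ e =
    ereal (poly (entry_poly A B e) (harm k) / harm k)"
proof -
  obtain i j where ij: "e = (i, j)" "i < p" "j < d" using e by auto
  have h: "harm k \<noteq> 0" "1 / harm k = real (Suc k)" using harm_pos[of k] by (simp_all add: harm_def)
  have "poly (entry_poly A B e) (harm k) / harm k =
    (if B $$ e < A $$ e then real_of_ereal (A $$ e) - pert k e
     else if B $$ e = -\<infinity> then pert k e - real (Suc k) else real_of_ereal (B $$ e) + pert k e)"
    using h by (simp add: entry_poly_def poly_monom field_simps)
  then show ?thesis
    using ij by (simp add: trop_add_mat_def relax_left_def relax_right_def rmax_mat_dim[OF A] del: power_Suc of_nat_Suc)
qed

text \<open>Two different sets of positions have equal sums for finitely many \<open>k\<close> only,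
  and there are finitely many pairs of sets.\<close>

lemma eventually_general_position:
  assumes A: "A \<in> rmax_mat p d"
  shows "\<forall>\<^sub>F k in sequentially. general_position (relax_left A B k) (relax_right A B k)"
proof -
  let ?G = "Pow ({..<p} \<times> {..<d})"
  have "\<forall>\<^sub>F k in sequentially. \<forall>E\<in>?G. \<forall>F\<in>?G. E \<noteq> F \<longrightarrow>
      poly (sum (entry_poly A B) E - sum (entry_poly A B) F) (harm k) \<noteq> 0"
  proof (intro eventually_ball_finite ballI)
    fix E F assume "E \<in> ?G" "F \<in> ?G"
    then have fin: "finite E" "finite F"
      using finite_subset[of _ "{..<p} \<times> {..<d}"] by simp_all
    show "\<forall>\<^sub>F k in sequentially. E \<noteq> F \<longrightarrow>
        poly (sum (entry_poly A B) E - sum (entry_poly A B) F) (harm k) \<noteq> 0"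
    proof (cases "E = F")
      case False
      then have "sum (entry_poly A B) E - sum (entry_poly A B) F \<noteq> 0"
        using sum_entry_poly_distinct[OF fin] by simp
      from eventually_poly_harm_nonzero[OF this] show ?thesis by (rule eventually_mono) simp
    qed simp
  qed simp_all
  then show ?thesis
  proof eventually_elim
    case (elim k)
    let ?C = "trop_add_mat (relax_left A B k) (relax_right A B k)"
    let ?c = "\<lambda>e. poly (entry_poly A B e) (harm k) / harm k"
    have C: "?C \<in> carrier_mat p d"
      by (simp add: trop_add_mat_def relax_left_def rmax_mat_dim[OF A])
    have "trop_nonsingular (submatrix ?C I J)"
      if "I \<subseteq> {..<p}" "J \<subseteq> {..<d}" "card I = card J" for I J
    proof (rule trop_nonsingular_submatrix[OF C that, where c = ?c])
      fix E F assume EF: "E \<subseteq> {..<p} \<times> {..<d}" "F \<subseteq> {..<p} \<times> {..<d}" "E \<noteq> F"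
      have "sum ?c G = poly (sum (entry_poly A B) G) (harm k) / harm k" for G
        by (simp add: poly_sum sum_divide_distrib)
      then show "sum ?c E \<noteq> sum ?c F"
        using elim EF harm_pos[of k] by (auto simp: divide_eq_eq)
    qed (rule relax_entry[OF A])
    moreover have "relax_left A B k $$ (i, j) + relax_right A B k $$ (i, j) = -\<infinity>"
      if "i < p" "j < d" for i j
      using that by (simp add: relax_left_def relax_right_def rmax_mat_dim[OF A])
    ultimately show ?case
      unfolding general_position_def by (simp add: rmax_mat_dim[OF relax_rmax(1)[OF A]])
  qed
qed

section \<open>Passing to general position and taking the maximum\<close>

lemma exists_general_position_card_le:
  assumes A: "A \<in> rmax_mat p d" and B: "B \<in> rmax_mat p d" and d: "d \<ge> 1"
  obtains A' B' where "A' \<in> rmax_mat p d" "B' \<in> rmax_mat p d" "general_position A' B'"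
    "card (extreme_rays (ineq_cone A B)) \<le> card (extreme_rays (ineq_cone A' B'))"
proof -
  interpret R: relaxation p d "left_part A B" "right_part A B" "relax_left A B" "relax_right A B"
    by (rule relaxation_relax[OF A B d])
  have "\<forall>\<^sub>F k in sequentially. general_position (relax_left A B k) (relax_right A B k) \<and>
      card (extreme_rays (ineq_cone A B)) \<le> card (extreme_rays (R.Vs k))"
    using eventually_general_position[OF A] R.eventually_card_extreme_rays_le
    unfolding ineq_cone_parts[OF A B d] by (rule eventually_conj)
  then obtain k where "general_position (relax_left A B k) (relax_right A B k)"
      "card (extreme_rays (ineq_cone A B)) \<le> card (extreme_rays (R.Vs k))"
    using eventually_happens' sequentially_bot by blast
  then show thesis using that relax_rmax[OF A] by blast
qed

theorem theorem14:
  fixes p d :: nat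
  assumes "p \<ge> 1" and "d \<ge> 1"
  shows "\<exists>A\<in>rmax_mat p d. \<exists>B\<in>rmax_mat p d. general_position A B \<and>
           (\<forall>A'\<in>rmax_mat p d. \<forall>B'\<in>rmax_mat p d.
              finite (extreme_rays (ineq_cone A' B')) \<and>
              card (extreme_rays (ineq_cone A' B')) \<le> card (extreme_rays (ineq_cone A B)))"
proof -
  let ?N = "\<lambda>(A, B). card (extreme_rays (ineq_cone A B))"
  let ?P = "\<lambda>AB. AB \<in> rmax_mat p d \<times> rmax_mat p d \<and> case_prod general_position AB"
  \<comment> \<open>Any starting pair yields one in general position, so the maximum below runs over
    a nonempty set.\<close>
  have zero: "0\<^sub>m p d \<in> rmax_mat p d" by (simp add: rmax_mat_def rmax_def)
  obtain A0 B0 where "?P (A0, B0)"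
    by (rule exists_general_position_card_le[OF zero zero assms(2)]) auto
  moreover have "?N AB < Suc (d * d ^ p)" if "?P AB" for AB
    using that extreme_rays_finite_card_le(2)[OF _ _ assms(2)] by (auto simp: less_Suc_eq_le)
  \<comment> \<open>The uniform bound gives a greatest number of rays among pairs in general
    position.\<close>
  ultimately obtain AB where AB: "?P AB" "\<And>AB'. ?P AB' \<Longrightarrow> ?N AB' \<le> ?N AB"
    using ex_has_greatest_nat[of ?P "(A0, B0)" ?N "Suc (d * d ^ p)"] by (metis less_imp_le)
  obtain A B where [simp]: "AB = (A, B)" by (cases AB)
  have "finite (extreme_rays (ineq_cone A' B')) \<and>
      card (extreme_rays (ineq_cone A' B')) \<le> card (extreme_rays (ineq_cone A B))"
    if A'B': "A' \<in> rmax_mat p d" "B' \<in> rmax_mat p d" for A' B'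
  proof
    show "finite (extreme_rays (ineq_cone A' B'))"
      by (rule extreme_rays_finite_card_le(1)[OF A'B' assms(2)])
    \<comment> \<open>An arbitrary pair is at least matched by one in general position, and that one
      by \<open>AB\<close>.\<close>
    obtain A'' B'' where *: "?P (A'', B'')" "?N (A', B') \<le> ?N (A'', B'')"
      by (rule exists_general_position_card_le[OF A'B' assms(2)]) auto
    then show "card (extreme_rays (ineq_cone A' B')) \<le> card (extreme_rays (ineq_cone A B))"
      using AB(2)[OF *(1)] by simp
  qed
  then show ?thesis using AB(1) by auto
qed

end
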